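(* Let $u^h\in X_h$ be strictly positive. Then, with a constant $C$ independent of $h$ and $u^h$, $$\sup_{x\in\mathcal O}(u^h)^{-1}\le C\Big(\frac1L\int_{\mathcal O}u^h\,dx\Big)^{-1}+C\,E_h[u^h]^{2/(p-2)}.$$ If in addition the bound $E_h[u^h]\le c_F\,h^{-\frac{p-2}{p+2}}$ holds, then $$\min_{x\in\mathcal O}u^h\ge h^{\frac{2}{p+2}}\qquad\text{and}\qquad\frac1L\int_{\mathcal O}u^h\,dx\ge h^{\frac{2}{p+2}},$$ and moreover $$\max\Big\{\frac{u^h(ih)}{u^h((i+1)h)},\frac{u^h(ih)}{u^h((i-1)h)}\Big\}\le1+\sqrt{2c_F}=:C_{osc}\qquad\text{for all }i=1,\dots,L_h.$$
   Context: $L>0$, $\mathcal O=(0,L)$ with periodic boundary conditions, $h>0$ with $L_h:=L/h\in\mathbb N$. $X_h$ is the space of $L$-periodic continuous functions that are linear on each interval $[(i-1)h,ih]$; $\mathcal I_h$ is nodal interpolation into $X_h$. The effective interface potential is $F(u)=c_Fu^{-p}$ for $u>0$, with $c_F>0$ and $p>n$, where $n\in(2,3)$ (in particular $p>2$). $E_h[v]:=\int_{\mathcal O}\frac12|v_x|^2+\mathcal I_h[F(v)]\,dx$. *)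

theory Defs
  imports "HOL-Analysis.Analysis"
begin

definition Xh :: "real \<Rightarrow> real \<Rightarrow> (real \<Rightarrow> real) set" where
  "Xh L h = {v. (\<forall>x. v (x + L) = v x) \<and> continuous_on UNIV v \<and>
     (\<forall>i::int. \<exists>a b. \<forall>x\<in>{(of_int i - 1) * h .. of_int i * h}. v x = a + b * x)}"

(* On [j h, (j+1) h), with j = floor (x / h), this is the affine function through the values of f
   at the two end points; the lemmas below show that, for L-periodic f, it is the unique element of Xh L h
   with the nodal values of f. *)
definition nodal_interp :: "real \<Rightarrow> (real \<Rightarrow> real) \<Rightarrow> real \<Rightarrow> real" where
  "nodal_interp h f x =
     (let j = real_of_int \<lfloor>x / h\<rfloor>
      in f (j * h) + (x / h - j) * (f ((j + 1) * h) - f (j * h)))"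

(* Only meaningful for u > 0. *)
definition F_pot :: "real \<Rightarrow> real \<Rightarrow> real \<Rightarrow> real" where
  "F_pot cF p u = cF * u powr (- p)"

(* For v in Xh L h the classical derivative exists off the finitely many nodes in (0, L) and
   coincides there with the weak derivative; the arbitrary values of deriv at the nodes do not
   affect the integral. *)
definition Eh :: "real \<Rightarrow> real \<Rightarrow> real \<Rightarrow> real \<Rightarrow> (real \<Rightarrow> real) \<Rightarrow> real" where
  "Eh L cF p h v =
     integral {0<..<L} (\<lambda>x. 1 / 2 * \<bar>deriv v x\<bar>\<^sup>2 + nodal_interp h (\<lambda>y. F_pot cF p (v y)) x)"

definition mean :: "real \<Rightarrow> (real \<Rightarrow> real) \<Rightarrow> real" where
  "mean L v = 1 / L * integral {0<..<L} v"

definition C_osc :: "real \<Rightarrow> real" where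
  "C_osc cF = 1 + sqrt (2 * cF)"

lemma nodal_interp_node:
  assumes "h > 0"
  shows "nodal_interp h f (of_int i * h) = f (of_int i * h)"
  using assms by (simp add: nodal_interp_def)

lemma nodal_interp_affine:
  assumes h: "h > 0" and x: "x \<in> {of_int i * h .. (of_int i + 1) * h}"
  shows "nodal_interp h f x =
    f (of_int i * h) + (x / h - of_int i) * (f ((of_int i + 1) * h) - f (of_int i * h))"
proof (cases "x = (of_int i + 1) * h")
  case True
  then have "nodal_interp h f x = f x"
    using nodal_interp_node[OF h, of f "i + 1"] by simp
  then show ?thesis using True h by simp
next
  case False
  then have "of_int i \<le> x / h" "x / h < of_int i + 1"
    using h x by (auto simp: field_simps)
  then have "\<lfloor>x / h\<rfloor> = i" by linarith
  then show ?thesis by (simp add: nodal_interp_def Let_def)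
qed

lemma nodal_interp_in_Xh:
  assumes h: "h > 0" and Lh: "L / h \<in> \<nat>" and per: "\<And>x. f (x + L) = f x"
  shows "nodal_interp h f \<in> Xh L h"
proof -
  let ?g = "nodal_interp h f"
  from Lh obtain N :: nat where "L / h = real N" by (auto simp: Nats_def)
  then have L: "L = real N * h" using h by (simp add: field_simps)
  have 1: "?g (x + L) = ?g x" for x
  proof -
    have q: "(x + L) / h = x / h + of_int (int N)" using h by (simp add: L field_simps)
    have "f ((of_int \<lfloor>x / h\<rfloor> + real N) * h) = f (of_int \<lfloor>x / h\<rfloor> * h)"
      using per[of "of_int \<lfloor>x / h\<rfloor> * h"] by (simp add: L algebra_simps)
    moreover have "f ((of_int \<lfloor>x / h\<rfloor> + real N + 1) * h) = f ((of_int \<lfloor>x / h\<rfloor> + 1) * h)"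
      using per[of "(of_int \<lfloor>x / h\<rfloor> + 1) * h"] by (simp add: L algebra_simps)
    ultimately show ?thesis unfolding nodal_interp_def Let_def q by simp
  qed
  have c1: "continuous_on {of_int i * h .. (of_int i + 1) * h} ?g" for i :: int
    by (rule continuous_on_eq[OF _ nodal_interp_affine[OF h, symmetric]])
       (use h in \<open>auto intro!: continuous_intros\<close>)
  have 2: "isCont ?g x" for x
  proof -
    define j where "j = \<lfloor>x / h\<rfloor>"
    have "of_int j \<le> x / h" "x / h < of_int j + 1" unfolding j_def by linarith+
    then have j: "of_int j * h \<le> x" "x < (of_int j + 1) * h"
      using h by (auto simp: field_simps)
    let ?I = "{of_int (j - 1) * h .. (of_int (j - 1) + 1) * h}"
    let ?J = "{of_int j * h .. (of_int j + 1) * h}"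
    have c: "continuous_on (?I \<union> ?J) ?g"
      by (rule continuous_on_closed_Un) (use c1[of "j - 1"] c1[of j] in simp_all)
    have "{(of_int j - 1) * h <..< (of_int j + 1) * h} \<subseteq> ?I \<union> ?J" by auto
    with c have "continuous_on {(of_int j - 1) * h <..< (of_int j + 1) * h} ?g"
      by (rule continuous_on_subset)
    moreover have "x \<in> {(of_int j - 1) * h <..< (of_int j + 1) * h}"
      using j h by (simp add: algebra_simps)
    ultimately show ?thesis
      by (simp add: continuous_on_eq_continuous_at)
  qed
  have 3: "\<exists>a b. \<forall>x\<in>{(of_int i - 1) * h .. of_int i * h}. ?g x = a + b * x" for i :: int
  proof -
    define d where "d = f (of_int i * h) - f ((of_int i - 1) * h)"
    have "?g x = (f ((of_int i - 1) * h) - (of_int i - 1) * d) + d / h * x"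
      if "x \<in> {(of_int i - 1) * h .. of_int i * h}" for x
      using nodal_interp_affine[OF h, of x "i - 1" f] that
      by (simp add: d_def algebra_simps diff_divide_distrib)
    then show ?thesis by blast
  qed
  show ?thesis
    unfolding Xh_def using 1 2 3 by (auto simp: continuous_on_eq_continuous_at)
qed

lemma nodal_interp_unique:
  assumes h: "h > 0" and v: "v \<in> Xh L h" and nodes: "\<And>i::int. v (of_int i * h) = f (of_int i * h)"
  shows "v = nodal_interp h f"
proof
  fix x
  define j where "j = \<lfloor>x / h\<rfloor>"
  have "of_int j \<le> x / h" "x / h < of_int j + 1" unfolding j_def by linarith+
  then have j: "of_int j * h \<le> x" "x \<le> (of_int j + 1) * h"
    using h by (auto simp: field_simps)
  have "\<exists>a b. \<forall>x\<in>{(of_int (j + 1) - 1) * h .. of_int (j + 1) * h}. v x = a + b * x"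
    using v unfolding Xh_def by blast
  then obtain a b where ab: "\<And>x. x \<in> {of_int j * h .. (of_int j + 1) * h} \<Longrightarrow> v x = a + b * x"
    by auto
  have "f (of_int j * h) = a + b * (of_int j * h)"
    using ab[of "of_int j * h"] nodes[of j] h by simp
  moreover have "f ((of_int j + 1) * h) = a + b * ((of_int j + 1) * h)"
    using ab[of "(of_int j + 1) * h"] nodes[of "j + 1"] h by simp
  moreover have "v x = a + b * x" using ab j by simp
  ultimately show "v x = nodal_interp h f x"
    using nodal_interp_affine[OF h, of x j f] j h by (simp add: field_simps)
qed

end

theory Submission
  imports Defs
begin

text \<open>
  Write u_j for the value of u at the node j h and N = L / h. As u is affine on every element and the
  interpolated potential is affine there too, the energy is a finite sum of contributions of the edges (u_j, u_{j+1}):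
  the squared jump over 2 h, plus h times the average of the two end values of F
  (\<open>Eh_eq_sum_edge_energy\<close>). The extrema of u are attained at nodes, and u is determined
  by N of them because of periodicity. Everything else is a statement about the positive numbers u_j.

  First estimate. Let q = p / 2 - 1 > 0. On one edge with end values a \<le> b, the mean value theorem bounds the
  change of s \<mapsto> s powr (- q) by q (b - a) a powr (- p / 2), and Young's inequality splits this product into
  (b - a)^2 / (2 h) and h a powr (- p) / 2. Both are controlled by the energy of that edge
  (\<open>powr_neg_diff_le_edge_energy\<close>). Only the nodal values of the potential enter, so that the estimate
  is not spoiled by the interpolation of F, and no power of h is lost. Summing
  from a minimal to a maximal node, whose value is at least the mean M of u, gives
  (min u) powr (- q) \<le> M powr (- q) + K E with K depending on p and cF alone.
  Taking the power 1 / q = 2 / (p - 2) yields the claim (\<open>inverse_le_mean_plus_energy\<close>).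

  Second estimate. Every single term of the sum is at most E. The potential terms give
  h cF u_j powr (- p) \<le> E, hence the lower bound \<mu> = h powr (2 / (p + 2)) when E is as small as assumed
  (\<open>lower_bound_of_small_energy\<close>); the jump terms give
  |u_{j+1} - u_j| \<le> sqrt (2 cF) \<mu> (\<open>jump_bound_of_small_energy\<close>). The two exponents agree: a jump is
  at most a fixed multiple of the minimum of u, which bounds the ratio of neighbouring values.
\<close>

section \<open>The energy as a sum over edges\<close>

text \<open>
  The energy of one element of length h on which the function goes from a to b; the potential enters by
  the trapezoidal rule, which is exact for its interpolant.
\<close>
definition edge_energy :: "real \<Rightarrow> real \<Rightarrow> real \<Rightarrow> real \<Rightarrow> real \<Rightarrow> real" where
  "edge_energy cF p h a b =
     (b - a)\<^sup>2 / (2 * h) + h * (F_pot cF p a + F_pot cF p b) / 2"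

lemma edge_energy_nonneg:
  assumes "cF > 0" "h > 0"
  shows "edge_energy cF p h a b \<ge> 0"
  using assms by (simp add: edge_energy_def F_pot_def)

lemma Xh_affine:
  assumes h: "h > 0" and v: "v \<in> Xh L h" and x: "x \<in> {of_int i * h .. (of_int i + 1) * h}"
  shows "v x = v (of_int i * h) + (x / h - of_int i) * (v ((of_int i + 1) * h) - v (of_int i * h))"
  using nodal_interp_affine[OF h x, of v] nodal_interp_unique[OF h v, of v] by metis

lemma Xh_deriv:
  assumes h: "h > 0" and v: "v \<in> Xh L h" and x: "x \<in> {of_int i * h <..< (of_int i + 1) * h}"
  shows "deriv v x = (v ((of_int i + 1) * h) - v (of_int i * h)) / h"
proof -
  define d where "d = v ((of_int i + 1) * h) - v (of_int i * h)"
  have "((\<lambda>y. v (of_int i * h) + (y / h - of_int i) * d) has_field_derivative d / h) (at x)"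
    by (use h in \<open>auto intro!: derivative_eq_intros\<close>)
  then have "(v has_field_derivative d / h) (at x)"
  proof (rule has_field_derivative_transform_within_open)
    show "open {of_int i * h <..< (of_int i + 1) * h}" by simp
    show "v (of_int i * h) + (y / h - of_int i) * d = v y"
      if "y \<in> {of_int i * h <..< (of_int i + 1) * h}" for y
      using Xh_affine[OF h v, of y i] that by (simp add: d_def)
  qed (use x in auto)
  then show ?thesis unfolding d_def by (rule DERIV_imp_deriv)
qed

lemma has_integral_element:
  assumes h: "h > 0" and v: "v \<in> Xh L h"
  shows "((\<lambda>x. 1 / 2 * \<bar>deriv v x\<bar>\<^sup>2 + nodal_interp h (\<lambda>y. F_pot cF p (v y)) x) has_integral
            edge_energy cF p h (v (real j * h)) (v (real (Suc j) * h)))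
          {real j * h .. real (Suc j) * h}" (is "(?g has_integral _) _")
proof -
  define a where "a = v (real j * h)"
  define b where "b = v (real (Suc j) * h)"
  define A where "A = F_pot cF p a"
  define B where "B = F_pot cF p b"
  define G where "G = (\<lambda>x. (1 / 2 * ((b - a) / h)\<^sup>2 + A) * x + h / 2 * (x / h - real j)\<^sup>2 * (B - A))"
  \<comment> \<open>Inside the element the integrand is affine, with antiderivative G. At the two nodes deriv v is
     unspecified, hence the detour through equality on the interior.\<close>
  have "((\<lambda>x. 1 / 2 * ((b - a) / h)\<^sup>2 + A + (x / h - real j) * (B - A)) has_integral
          G (real (Suc j) * h) - G (real j * h)) {real j * h .. real (Suc j) * h}"
  proof (rule fundamental_theorem_of_calculus)
    show "(G has_vector_derivative 1 / 2 * ((b - a) / h)\<^sup>2 + A + (x / h - real j) * (B - A))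
            (at x within {real j * h .. real (Suc j) * h})" for x
      unfolding G_def has_real_derivative_iff_has_vector_derivative[symmetric]
      using h by (auto intro!: derivative_eq_intros)
  qed (use h in simp)
  also have "G (real (Suc j) * h) - G (real j * h) = edge_energy cF p h a b"
    unfolding G_def edge_energy_def A_def[symmetric] B_def[symmetric]
    using h by (simp add: field_simps power2_eq_square)
  finally have "(?g has_integral edge_energy cF p h a b) {real j * h .. real (Suc j) * h}"
  proof (rule has_integral_spike_interior[of _ _ "real j * h" "real (Suc j) * h", simplified box_real])
    fix x assume x: "x \<in> {real j * h <..< real (Suc j) * h}"
    have "deriv v x = (b - a) / h"
      using Xh_deriv[OF h v, of x "int j"] x by (simp add: a_def b_def add.commute)
    moreover have "nodal_interp h (\<lambda>y. F_pot cF p (v y)) x = A + (x / h - real j) * (B - A)"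
      using nodal_interp_affine[OF h, of x "int j" "\<lambda>y. F_pot cF p (v y)"] x
      by (simp add: a_def b_def A_def B_def add.commute)
    ultimately show "?g x = 1 / 2 * ((b - a) / h)\<^sup>2 + A + (x / h - real j) * (B - A)"
      by (simp only: power2_abs)
  qed
  then show ?thesis by (simp add: a_def b_def)
qed

lemma Eh_eq_sum_edge_energy:
  assumes h: "h > 0" and v: "v \<in> Xh L h" and L: "L = real N * h"
  shows "Eh L cF p h v = (\<Sum>j<N. edge_energy cF p h (v (real j * h)) (v (real (Suc j) * h)))"
proof -
  let ?g = "\<lambda>x. 1 / 2 * \<bar>deriv v x\<bar>\<^sup>2 + nodal_interp h (\<lambda>y. F_pot cF p (v y)) x"
  have "(?g has_integral (\<Sum>j<M. edge_energy cF p h (v (real j * h)) (v (real (Suc j) * h))))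
          {0 .. real M * h}" for M
  proof (induction M)
    case (Suc M)
    have "real M * h \<ge> 0" "real M * h \<le> real (Suc M) * h" using h by (auto simp: mult_right_mono)
    from has_integral_combine[OF this Suc.IH has_integral_element[OF h v]]
    show ?case by simp
  qed (simp add: has_integral_refl)
  from this[of N] show ?thesis
    unfolding Eh_def L has_integral_Icc_iff_Ioo by (rule integral_unique)
qed

section \<open>Extrema and mean of finite element functions\<close>

lemma Xh_periodic_int:
  assumes v: "v \<in> Xh L h"
  shows "v (x + of_int k * L) = v x"
proof -
  have per: "v (y + L) = v y" for y using v by (simp add: Xh_def)
  have nat: "v (y + real m * L) = v y" for y m
  proof (induction m)
    case (Suc m)
    then show ?case using per[of "y + real m * L"] by (simp add: algebra_simps)
  qed simp
  show ?thesis
  proof (cases "k \<ge> 0")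
    case True
    then show ?thesis using nat[of x "nat k"] by simp
  next
    case False
    then show ?thesis using nat[of "x + of_int k * L" "nat (- k)"] by simp
  qed
qed

lemma Xh_node_reduce:
  assumes v: "v \<in> Xh L h" and L: "L = real N * h" and N: "N > 0"
  obtains k where "k < N" "v (of_int i * h) = v (real k * h)"
proof
  let ?k = "nat (i mod int N)"
  show "?k < N" using N by (simp add: nat_less_iff)
  have "i = i mod int N + i div int N * int N" by simp
  then have "of_int i * h = (of_int (i mod int N) + of_int (i div int N) * real N) * h"
    by (metis of_int_add of_int_mult of_int_of_nat_eq)
  also have "\<dots> = real ?k * h + of_int (i div int N) * L"
    using N by (simp add: L algebra_simps)
  finally show "v (of_int i * h) = v (real ?k * h)" using Xh_periodic_int[OF v] by simp
qed

lemma Xh_between_nodes: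
  assumes h: "h > 0" and v: "v \<in> Xh L h" and L: "L = real N * h" and N: "N > 0"
  obtains k l where "k < N" "l < N" "v (real k * h) \<le> v x" "v x \<le> v (real l * h)"
proof -
  define i where "i = \<lfloor>x / h\<rfloor>"
  define t where "t = x / h - of_int i"
  have t: "0 \<le> t" "t \<le> 1" unfolding t_def i_def by linarith+
  then have x: "x \<in> {of_int i * h .. (of_int i + 1) * h}"
    using h by (auto simp: t_def field_simps)
  obtain k where k: "k < N" "v (of_int i * h) = v (real k * h)"
    using Xh_node_reduce[OF v L N] .
  obtain l where l: "l < N" "v (of_int (i + 1) * h) = v (real l * h)"
    using Xh_node_reduce[OF v L N] .
  define a where "a = v (real k * h)"
  define b where "b = v (real l * h)"
  have vx: "v x = a + t * (b - a)"
    using Xh_affine[OF h v x] k l by (simp add: a_def b_def t_def)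
  show ?thesis
  proof (cases "a \<le> b")
    case True
    then have "0 \<le> t * (b - a)" "t * (b - a) \<le> b - a"
      using t by (simp_all add: mult_left_le_one_le)
    then show ?thesis using that[of k l] k l vx by (simp add: a_def b_def)
  next
    case False
    then have "0 \<le> t * (a - b)" "t * (a - b) \<le> a - b"
      using t by (simp_all add: mult_left_le_one_le)
    then show ?thesis using that[of l k] k l vx by (simp add: a_def b_def algebra_simps)
  qed
qed

text \<open>
  By the affine interpolation every value of v lies between two nodal values, and by periodicity there are only
  finitely many of those.
\<close>
lemma Xh_extremal_nodes:
  assumes h: "h > 0" and v: "v \<in> Xh L h" and L: "L = real N * h" and N: "N > 0"
  obtains k l where "k < N" "\<forall>x. v (real k * h) \<le> v x" "l < N" "\<forall>x. v x \<le> v (real l * h)"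
proof -
  let ?V = "(\<lambda>j. v (real j * h)) ` {..<N}"
  have V: "finite ?V" "?V \<noteq> {}" using N by auto
  obtain k where k: "k < N" "v (real k * h) = Min ?V" using Min_in[OF V] by auto
  obtain l where l: "l < N" "v (real l * h) = Max ?V" using Max_in[OF V] by auto
  have "Min ?V \<le> v x" "v x \<le> Max ?V" for x
  proof -
    obtain k' l' where kl: "k' < N" "l' < N" "v (real k' * h) \<le> v x" "v x \<le> v (real l' * h)"
      using Xh_between_nodes[OF h v L N] .
    from kl(1,3) show "Min ?V \<le> v x" by (intro order_trans[OF Min_le]) auto
    from kl(2,4) show "v x \<le> Max ?V" by (intro order_trans[OF _ Max_ge]) auto
  qed
  then show ?thesis using k l by (intro that[of k l]) simp_all
qed

lemma Xh_integrable:
  assumes "v \<in> Xh L h"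
  shows "v integrable_on {0<..<L}"
proof -
  have "continuous_on {0..L} v"
    using assms by (auto simp: Xh_def intro: continuous_on_subset)
  then show ?thesis
    using integrable_continuous_real integrable_on_Icc_iff_Ioo by blast
qed

lemma mean_bounds:
  assumes L: "L > 0" and v: "v \<in> Xh L h"
  shows mean_ge: "(\<And>x. c \<le> v x) \<Longrightarrow> c \<le> mean L v"
    and mean_le: "(\<And>x. v x \<le> c) \<Longrightarrow> mean L v \<le> c"
proof -
  have const: "((\<lambda>_. c) has_integral c * L) {0<..<L}"
    using has_integral_const_real[of c 0 L] L
    by (simp add: has_integral_Icc_iff_Ioo mult.commute)
  have int: "(v has_integral mean L v * L) {0<..<L}"
    using Xh_integrable[OF v] L by (simp add: mean_def has_integral_integral)
  show "c \<le> mean L v" if "\<And>x. c \<le> v x"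
    using has_integral_le[OF const int that] L by simp
  show "mean L v \<le> c" if "\<And>x. v x \<le> c"
    using has_integral_le[OF int const that] L by simp
qed

section \<open>The bound by the mean and the energy\<close>

text \<open>
  The exponent q = p / 2 - 1 is the one for which the derivative of s powr (- q) squares to a multiple of
  s powr (- p), that is, of the potential. It makes Young's inequality reproduce the two
  parts of the energy with matching powers of h. The mean value theorem is used at the smaller end a, where the
  derivative is largest; this replaces a pointwise estimate inside the element by nodal values.
\<close>
lemma powr_neg_diff_le_edge_energy_ordered:
  fixes a b q :: real
  assumes ab: "0 < a" "a \<le> b" and p: "p > 2" and h: "h > 0" and cF: "cF > 0"
  defines "q \<equiv> p / 2 - 1"
  shows "a powr - q - b powr - q \<le> q * max 1 (1 / cF) * edge_energy cF p h a b"
proof (cases "a = b")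
  case True
  then show ?thesis using edge_energy_nonneg[OF cF h] p by (simp add: q_def)
next
  case False
  then have "a < b" using ab by simp
  have q: "q > 0" using p by (simp add: q_def)
  have "\<exists>z. a < z \<and> z < b \<and> b powr - q - a powr - q = (b - a) * (- q * z powr (- q - 1))"
  proof (rule MVT2[OF \<open>a < b\<close>])
    fix x assume "a \<le> x"
    then show "((\<lambda>x. x powr - q) has_real_derivative - q * x powr (- q - 1)) (at x)"
      using ab by (auto intro!: derivative_eq_intros)
  qed
  then obtain z where z: "a < z" "b powr - q - a powr - q = (b - a) * (- q * z powr (- q - 1))"
    by blast
  define s where "s = a powr (- q - 1)"
  have s2: "s\<^sup>2 = a powr - p"
    unfolding s_def power2_eq_square powr_add[symmetric] by (simp add: q_def)
  have zs: "z powr (- q - 1) \<le> s"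
    unfolding s_def using z ab q by (intro powr_mono2') auto
  let ?P = "(b - a)\<^sup>2 / (2 * h)" and ?K = "max 1 (1 / cF)"
  \<comment> \<open>Young's inequality, weighted by h so that both terms scale like the edge energy.\<close>
  have young: "(b - a) * s \<le> ?P + h * s\<^sup>2 / 2"
  proof -
    have "0 \<le> ((b - a) - h * s)\<^sup>2 / (2 * h)" using h by simp
    also have "\<dots> = ?P + h * s\<^sup>2 / 2 - (b - a) * s"
      using h by (simp add: field_simps power2_eq_square)
    finally show ?thesis by simp
  qed
  have "s\<^sup>2 = 1 / cF * F_pot cF p a" using cF by (simp add: F_pot_def s2)
  \<comment> \<open>The factor ?K is at least 1 / cF for the potential part and at least 1 for the jump part.\<close>
  also have "\<dots> \<le> ?K * (F_pot cF p a + F_pot cF p b)"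
    using cF by (intro mult_mono) (auto simp: F_pot_def)
  finally have "h * s\<^sup>2 / 2 \<le> ?K * (h * (F_pot cF p a + F_pot cF p b) / 2)"
    using h by (simp add: mult_left_mono mult.left_commute)
  moreover have "?P \<le> ?K * ?P" using h mult_right_mono[of 1 ?K ?P] by simp
  ultimately have "?P + h * s\<^sup>2 / 2 \<le> ?K * edge_energy cF p h a b"
    unfolding edge_energy_def distrib_left[of ?K] by (rule add_mono[rotated])
  with young have "q * ((b - a) * s) \<le> q * (?K * edge_energy cF p h a b)"
    using q by (intro mult_left_mono) auto
  moreover have "a powr - q - b powr - q = q * ((b - a) * z powr (- q - 1))"
    using z by (simp add: algebra_simps)
  moreover have "q * ((b - a) * z powr (- q - 1)) \<le> q * ((b - a) * s)"
    using q zs ab by (intro mult_left_mono) auto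
  ultimately show ?thesis by (simp add: mult.assoc)
qed

lemma powr_neg_diff_le_edge_energy:
  fixes a b q :: real
  assumes ab: "0 < a" "0 < b" and p: "p > 2" and h: "h > 0" and cF: "cF > 0"
  defines "q \<equiv> p / 2 - 1"
  shows "\<bar>a powr - q - b powr - q\<bar> \<le> q * max 1 (1 / cF) * edge_energy cF p h a b"
proof -
  have sym: "edge_energy cF p h b a = edge_energy cF p h a b"
    by (simp add: edge_energy_def power2_commute add.commute)
  have mono: "y powr - q \<le> x powr - q" if "0 < x" "x \<le> y" for x y :: real
    using that p by (intro powr_mono2') (auto simp: q_def)
  show ?thesis
  proof (cases "a \<le> b")
    case True
    then show ?thesis
      using powr_neg_diff_le_edge_energy_ordered[OF ab(1) True p h cF] mono[OF ab(1) True]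
      by (simp add: q_def[symmetric])
  next
    case False
    then have "b \<le> a" by simp
    then show ?thesis
      using powr_neg_diff_le_edge_energy_ordered[OF ab(2) \<open>b \<le> a\<close> p h cF] mono[OF ab(2) \<open>b \<le> a\<close>]
      by (simp add: q_def[symmetric] sym)
  qed
qed

lemma diff_le_total_variation:
  fixes f :: "nat \<Rightarrow> real"
  assumes "j \<le> N" "k \<le> N"
  shows "\<bar>f j - f k\<bar> \<le> (\<Sum>i<N. \<bar>f i - f (Suc i)\<bar>)"
proof -
  have *: "\<bar>f j - f k\<bar> \<le> (\<Sum>i<N. \<bar>f i - f (Suc i)\<bar>)" if "j \<le> k" "k \<le> N" for j k
  proof -
    have "\<bar>f j - f k\<bar> = \<bar>\<Sum>i=j..<k. f i - f (Suc i)\<bar>"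
      using sum_Suc_diff'[OF that(1), of "\<lambda>i. - f i"] by (simp add: add.commute)
    also have "\<dots> \<le> (\<Sum>i=j..<k. \<bar>f i - f (Suc i)\<bar>)" by (rule sum_abs)
    also have "\<dots> \<le> (\<Sum>i<N. \<bar>f i - f (Suc i)\<bar>)" using that by (intro sum_mono2) auto
    finally show ?thesis .
  qed
  show ?thesis using *[of j k] *[of k j] assms by (cases "j \<le> k") (auto simp: abs_minus_commute)
qed

lemma powr_add_le_two_powr:
  fixes x y r :: real
  assumes "x \<ge> 0" "y \<ge> 0" "r \<ge> 0"
  shows "(x + y) powr r \<le> 2 powr r * (x powr r + y powr r)"
proof -
  have "(x + y) powr r \<le> (2 * max x y) powr r"
    using assms by (intro powr_mono2) auto
  also have "\<dots> = 2 powr r * max x y powr r" using assms by (simp add: powr_mult)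
  also have "\<dots> \<le> 2 powr r * (x powr r + y powr r)"
    by (intro mult_left_mono) (auto simp: max_def)
  finally show ?thesis .
qed

text \<open>
  The total variation of the nodal values of u powr (- q) is at most a multiple of the energy. Compared at a
  minimal and at a maximal node this controls the minimum of u from below, since the maximum is at least the mean.
  All constants depend on p and cF alone, so they are uniform in h and u.
\<close>
lemma inverse_le_mean_plus_energy:
  fixes L cF p h :: real
  assumes L0: "L > 0" and cF: "cF > 0" and p: "p > 2" and h: "h > 0" and Lh: "L / h \<in> \<nat>"
    and u: "u \<in> Xh L h" and pos: "\<And>x. u x > 0"
  defines "q \<equiv> p / 2 - 1"
  shows "inverse (u x) \<le> 2 powr (1 / q) *
           (inverse (mean L u) + (q * max 1 (1 / cF)) powr (1 / q) * Eh L cF p h u powr (1 / q))"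
proof -
  obtain N :: nat where "L / h = real N" using Lh by (auto simp: Nats_def)
  then have L: "L = real N * h" using h by (simp add: field_simps)
  with L0 have N: "N > 0" by (cases N) auto
  have q: "q > 0" using p by (simp add: q_def)
  define E where "E = Eh L cF p h u"
  define K where "K = q * max 1 (1 / cF)"
  have K: "K \<ge> 0" using q by (simp add: K_def)
  have E_sum: "E = (\<Sum>j<N. edge_energy cF p h (u (real j * h)) (u (real (Suc j) * h)))"
    unfolding E_def by (rule Eh_eq_sum_edge_energy[OF h u L])
  then have E: "E \<ge> 0" by (simp add: sum_nonneg edge_energy_nonneg[OF cF h])
  obtain k m where k: "k < N" "\<forall>y. u (real k * h) \<le> u y"
    and m: "m < N" "\<forall>y. u y \<le> u (real m * h)"
    using Xh_extremal_nodes[OF h u L N] .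
  have mean_pos: "mean L u > 0" using mean_ge[OF L0 u k(2)[rule_format]] pos less_le_trans by blast
  have mean_m: "mean L u \<le> u (real m * h)" using mean_le[OF L0 u m(2)[rule_format]] .
  let ?f = "\<lambda>j. u (real j * h) powr - q"
  have "\<bar>?f k - ?f m\<bar> \<le> (\<Sum>i<N. \<bar>?f i - ?f (Suc i)\<bar>)"
    using k m by (intro diff_le_total_variation) auto
  also have "\<dots> \<le> (\<Sum>i<N. K * edge_energy cF p h (u (real i * h)) (u (real (Suc i) * h)))"
    unfolding K_def q_def by (intro sum_mono powr_neg_diff_le_edge_energy pos p h cF)
  also have "\<dots> = K * E" by (simp add: E_sum sum_distrib_left)
  finally have "?f k \<le> ?f m + K * E" by simp
  also have "?f m \<le> mean L u powr - q"
    using mean_m mean_pos q by (intro powr_mono2') auto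
  finally have fk: "?f k \<le> mean L u powr - q + K * E" by simp
  have root: "(y powr - q) powr (1 / q) = inverse y" if "y > 0" for y :: real
    using that q using powr_minus[of y 1] by (simp add: powr_powr)
  have "inverse (u x) \<le> inverse (u (real k * h))"
    using k pos by (simp add: le_imp_inverse_le)
  also have "\<dots> = ?f k powr (1 / q)" using root[OF pos] by simp
  also have "\<dots> \<le> (mean L u powr - q + K * E) powr (1 / q)"
    using fk q by (intro powr_mono2) auto
  also have "\<dots> \<le> 2 powr (1 / q) * ((mean L u powr - q) powr (1 / q) + (K * E) powr (1 / q))"
    using K E q by (intro powr_add_le_two_powr) auto
  also have "\<dots> = 2 powr (1 / q) * (inverse (mean L u) + K powr (1 / q) * E powr (1 / q))"
    using root[OF mean_pos] K E by (simp add: powr_mult)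
  finally show ?thesis unfolding K_def E_def .
qed

section \<open>Consequences of small energy\<close>

text \<open>
  By periodicity the averages of F over the edges add up to the plain sum over the nodes. Each node
  therefore contributes with the full weight h; using a single edge would only give h / 2 and
  spoil the constants of the lower bound.
\<close>
lemma Eh_term_le:
  fixes L cF p h :: real
  assumes cF: "cF > 0" and h: "h > 0" and u: "u \<in> Xh L h" and L: "L = real N * h" and k: "k < N"
  shows "h * F_pot cF p (u (real k * h)) \<le> Eh L cF p h u"
    and "(u (real (Suc k) * h) - u (real k * h))\<^sup>2 \<le> 2 * h * Eh L cF p h u"
proof -
  let ?u = "\<lambda>j. u (real j * h)"
  let ?F = "\<lambda>j. F_pot cF p (?u j)"
  define D where "D = (\<Sum>j<N. (?u (Suc j) - ?u j)\<^sup>2 / (2 * h))"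
  define P where "P = (\<Sum>j<N. h * ?F j)"
  have "?u N = ?u 0" using u L by (auto simp: Xh_def dest: spec[of _ 0])
  then have "(\<Sum>j<N. ?F (Suc j)) = (\<Sum>j<N. ?F j)"
    using sum.lessThan_Suc_shift[of ?F N] by simp
  then have E: "Eh L cF p h u = D + P"
    unfolding Eh_eq_sum_edge_energy[OF h u L] edge_energy_def D_def P_def
    by (simp add: sum.distrib flip: sum_distrib_left sum_divide_distrib)
  have D: "D \<ge> 0" unfolding D_def using h by (intro sum_nonneg) auto
  have P: "P \<ge> 0" unfolding P_def using h cF by (intro sum_nonneg) (auto simp: F_pot_def)
  have "h * ?F k \<le> P"
    unfolding P_def using h cF k by (intro member_le_sum) (auto simp: F_pot_def)
  then show "h * ?F k \<le> Eh L cF p h u" using E D by simp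
  have "(?u (Suc k) - ?u k)\<^sup>2 / (2 * h) \<le> D"
    unfolding D_def using h k by (intro member_le_sum[of k _ "\<lambda>j. (?u (Suc j) - ?u j)\<^sup>2 / (2 * h)"]) auto
  then have "(?u (Suc k) - ?u k)\<^sup>2 / (2 * h) \<le> Eh L cF p h u" using E P by simp
  then show "(?u (Suc k) - ?u k)\<^sup>2 \<le> 2 * h * Eh L cF p h u" using h by (simp add: field_simps)
qed

text \<open>
  The bound on the energy is chosen such that cF cancels: what remains is
  h a powr (- p) \<le> h powr (- (p - 2) / (p + 2)) at a minimal node value a, and dividing by h turns the
  right side into the power - p of h powr (2 / (p + 2)).
\<close>
lemma lower_bound_of_small_energy:
  fixes L cF p h :: real
  assumes L0: "L > 0" and cF: "cF > 0" and p: "p > 2" and h: "h > 0" and L: "L = real N * h"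
    and u: "u \<in> Xh L h" and pos: "\<And>x. u x > 0"
    and E: "Eh L cF p h u \<le> cF * h powr (- ((p - 2) / (p + 2)))"
  shows "h powr (2 / (p + 2)) \<le> u x"
proof -
  have N: "N > 0" using L L0 by (cases N) auto
  obtain k l where k: "k < N" "\<forall>y. u (real k * h) \<le> u y"
    and "l < N" "\<forall>y. u y \<le> u (real l * h)"
    using Xh_extremal_nodes[OF h u L N] .
  define a where "a = u (real k * h)"
  have a: "a > 0" unfolding a_def by (rule pos)
  have "cF * (h * a powr - p) \<le> cF * h powr (- ((p - 2) / (p + 2)))"
    using Eh_term_le(1)[OF cF h u L k(1), of p] E by (simp add: F_pot_def a_def mult_ac)
  then have "h * a powr - p \<le> h powr (- ((p - 2) / (p + 2)))" using cF by simp
  then have "a powr - p \<le> h powr (- ((p - 2) / (p + 2))) / h" using h by (simp add: field_simps)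
  also have "\<dots> = h powr (- ((p - 2) / (p + 2)) - 1)" using h by (simp add: powr_diff)
  also have "- ((p - 2) / (p + 2)) - 1 = 2 / (p + 2) * - p" using p by (simp add: field_simps)
  also have "h powr (2 / (p + 2) * - p) = (h powr (2 / (p + 2))) powr - p"
    by (simp only: powr_powr)
  finally have "\<not> a < h powr (2 / (p + 2))"
    using powr_less_mono2_neg[of "- p" a "h powr (2 / (p + 2))"] a p by auto
  then show ?thesis using k(2)[rule_format, of x] unfolding a_def by linarith
qed

text \<open>
  The square of a jump is at most 2 h E, that is 2 cF h powr (4 / (p + 2)), whose root has the same power of h as the
  lower bound for u. Arbitrary j is allowed because neighbours of the last node lie beyond the period.
\<close>
lemma jump_bound_of_small_energy:
  fixes L cF p h :: real
  assumes L0: "L > 0" and cF: "cF > 0" and p: "p > 2" and h: "h > 0" and L: "L = real N * h"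
    and u: "u \<in> Xh L h"
    and E: "Eh L cF p h u \<le> cF * h powr (- ((p - 2) / (p + 2)))"
  shows "\<bar>u (real (Suc j) * h) - u (real j * h)\<bar> \<le> sqrt (2 * cF) * h powr (2 / (p + 2))"
proof -
  have N: "N > 0" using L L0 by (cases N) auto
  define k where "k = j mod N"
  have k: "k < N" using N by (simp add: k_def)
  have "real j = real k + real (j div N) * real N"
    unfolding k_def by (metis add.commute div_mult_mod_eq of_nat_add of_nat_mult)
  then have j: "real j * h = real k * h + of_int (int (j div N)) * L"
    "real (Suc j) * h = real (Suc k) * h + of_int (int (j div N)) * L"
    by (simp_all add: L algebra_simps)
  \<comment> \<open>Translation to the edge k inside the first period.\<close>
  have "(u (real (Suc j) * h) - u (real j * h))\<^sup>2 = (u (real (Suc k) * h) - u (real k * h))\<^sup>2"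
    unfolding j Xh_periodic_int[OF u] ..
  also have "\<dots> \<le> 2 * h * Eh L cF p h u" by (rule Eh_term_le(2)[OF cF h u L k])
  also have "\<dots> \<le> 2 * h * (cF * h powr (- ((p - 2) / (p + 2))))"
    using E h by (intro mult_left_mono) auto
  also have "\<dots> = 2 * cF * h powr (1 + - ((p - 2) / (p + 2)))"
    unfolding powr_add using h by simp
  also have "1 + - ((p - 2) / (p + 2)) = 2 / (p + 2) + 2 / (p + 2)"
  proof -
    have "1 + - ((p - 2) / (p + 2)) = 4 / (p + 2)" using p by (simp add: divide_simps)
    then show ?thesis by simp
  qed
  also have "2 * cF * h powr (2 / (p + 2) + 2 / (p + 2)) = (sqrt (2 * cF) * h powr (2 / (p + 2)))\<^sup>2"
    unfolding powr_add using cF by (simp add: power_mult_distrib power2_eq_square[of "h powr _"])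
  finally have "\<bar>u (real (Suc j) * h) - u (real j * h)\<bar> \<le> \<bar>sqrt (2 * cF) * h powr (2 / (p + 2))\<bar>"
    by (simp only: abs_le_square_iff)
  then show ?thesis using cF by simp
qed

theorem lemma4p1:
  fixes L cF p n :: real
  assumes "L > 0" and "cF > 0" and "2 < n" and "n < 3" and "p > n"
  shows
    "(\<exists>C>0. \<forall>h>0. L / h \<in> \<nat> \<longrightarrow>
        (\<forall>u\<in>Xh L h. (\<forall>x. u x > 0) \<longrightarrow>
           bdd_above ((\<lambda>x. inverse (u x)) ` {0<..<L}) \<and>
           (SUP x\<in>{0<..<L}. inverse (u x))
             \<le> C * inverse (mean L u) + C * Eh L cF p h u powr (2 / (p - 2))))
     \<and>
     (\<forall>h>0. L / h \<in> \<nat> \<longrightarrow>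
        (\<forall>u\<in>Xh L h. (\<forall>x. u x > 0) \<longrightarrow>
           Eh L cF p h u \<le> cF * h powr (- ((p - 2) / (p + 2))) \<longrightarrow>
             (\<exists>x0\<in>{0..L}. (\<forall>x\<in>{0..L}. u x0 \<le> u x) \<and> u x0 \<ge> h powr (2 / (p + 2))) \<and>
             mean L u \<ge> h powr (2 / (p + 2)) \<and>
             (\<forall>i::nat. 1 \<le> i \<and> real i \<le> L / h \<longrightarrow>
                max (u (real i * h) / u ((real i + 1) * h))
                    (u (real i * h) / u ((real i - 1) * h)) \<le> C_osc cF)))"
proof -
  have p: "p > 2" using assms by simp
  define q where "q = p / 2 - 1"
  have q: "q > 0" and q_inv: "1 / q = 2 / (p - 2)" using p by (simp_all add: q_def field_simps)
  define K where "K = q * max 1 (1 / cF)"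
  define C where "C = 2 powr (1 / q) * max 1 (K powr (1 / q))"
  have C: "C > 0" by (simp add: C_def less_max_iff_disj)
  have 1: "bdd_above ((\<lambda>x. inverse (u x)) ` {0<..<L}) \<and>
        (SUP x\<in>{0<..<L}. inverse (u x)) \<le> C * inverse (mean L u) + C * Eh L cF p h u powr (2 / (p - 2))"
    if h: "h > 0" "L / h \<in> \<nat>" and u: "u \<in> Xh L h" and pos: "\<forall>x. u x > 0" for h u
  proof -
    let ?m = "inverse (mean L u)" and ?e = "Eh L cF p h u powr (1 / q)"
    have m: "?m \<ge> 0"
      using mean_ge[OF \<open>L > 0\<close> u, of 0] pos by (simp add: less_imp_le)
    have "inverse (u x) \<le> C * ?m + C * ?e" for x
    proof -
      have "inverse (u x) \<le> 2 powr (1 / q) * (?m + K powr (1 / q) * ?e)"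
        using inverse_le_mean_plus_energy[OF \<open>L > 0\<close> \<open>cF > 0\<close> p h u, of x] pos
        by (simp only: q_def K_def)
      also have "\<dots> \<le> 2 powr (1 / q) * (max 1 (K powr (1 / q)) * ?m + max 1 (K powr (1 / q)) * ?e)"
        using m mult_right_mono[of 1 "max 1 (K powr (1 / q))" ?m]
        by (intro mult_left_mono add_mono mult_right_mono) auto
      finally show ?thesis by (simp add: C_def algebra_simps)
    qed
    then show ?thesis
      unfolding q_inv using \<open>L > 0\<close> by (auto intro!: cSUP_least bdd_aboveI2)
  qed
  have 2:
    "(\<exists>x0\<in>{0..L}. (\<forall>x\<in>{0..L}. u x0 \<le> u x) \<and> u x0 \<ge> h powr (2 / (p + 2))) \<and>
     mean L u \<ge> h powr (2 / (p + 2)) \<and>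
     (\<forall>i::nat. 1 \<le> i \<and> real i \<le> L / h \<longrightarrow>
        max (u (real i * h) / u ((real i + 1) * h)) (u (real i * h) / u ((real i - 1) * h)) \<le> C_osc cF)"
    if h: "h > 0" "L / h \<in> \<nat>" and u: "u \<in> Xh L h" and pos: "\<forall>x. u x > 0"
      and E: "Eh L cF p h u \<le> cF * h powr (- ((p - 2) / (p + 2)))" for h u
  proof (intro conjI allI impI)
    obtain N :: nat where "L / h = real N" using h by (auto simp: Nats_def)
    then have L: "L = real N * h" using h by (simp add: field_simps)
    let ?\<mu> = "h powr (2 / (p + 2))"
    have low: "?\<mu> \<le> u x" for x
      using lower_bound_of_small_energy[OF \<open>L > 0\<close> \<open>cF > 0\<close> p h(1) L u _ E] pos by blast
    have "continuous_on {0..L} u" using u by (auto simp: Xh_def intro: continuous_on_subset)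
    then obtain x0 where "x0 \<in> {0..L}" "\<forall>x\<in>{0..L}. u x0 \<le> u x"
      using continuous_attains_inf[of "{0..L}" u] \<open>L > 0\<close> by auto
    then show "\<exists>x0\<in>{0..L}. (\<forall>x\<in>{0..L}. u x0 \<le> u x) \<and> u x0 \<ge> ?\<mu>" using low by blast
    show "?\<mu> \<le> mean L u" by (rule mean_ge[OF \<open>L > 0\<close> u low])
    fix i :: nat assume i: "1 \<le> i \<and> real i \<le> L / h"
    have jump: "\<bar>u (real (Suc j) * h) - u (real j * h)\<bar> \<le> sqrt (2 * cF) * ?\<mu>" for j
      by (rule jump_bound_of_small_energy[OF \<open>L > 0\<close> \<open>cF > 0\<close> p h(1) L u E])
    \<comment> \<open>The lower bound for u turns the absolute bound on a jump into a bound relative to the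
       denominator u y, whichever of the two neighbours that is.\<close>
    have ratio: "u x / u y \<le> C_osc cF" if "\<bar>u x - u y\<bar> \<le> sqrt (2 * cF) * ?\<mu>" for x y
    proof -
      have "sqrt (2 * cF) * ?\<mu> \<le> sqrt (2 * cF) * u y"
        using low \<open>cF > 0\<close> by (intro mult_left_mono) auto
      then have "u x \<le> C_osc cF * u y" using that by (simp add: C_osc_def algebra_simps)
      then show ?thesis using pos by (simp add: divide_le_eq)
    qed
    have "u (real i * h) / u ((real i + 1) * h) \<le> C_osc cF"
      using ratio jump[of i] by (simp add: abs_minus_commute add.commute)
    moreover have "u (real i * h) / u ((real i - 1) * h) \<le> C_osc cF"
      using ratio jump[of "i - 1"] i by (simp add: of_nat_diff)
    ultimately show "max (u (real i * h) / u ((real i + 1) * h)) (u (real i * h) / u ((real i - 1) * h))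
        \<le> C_osc cF" by simp
  qed
  show ?thesis by (intro conjI exI[of _ C] allI impI ballI C) (use 1 2 in simp_all)
qed

end
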